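(* For two operator-valued p-ASFs $(\{A_n\}_{n},\{\Psi_n\}_{n})$ and $(\{B_n\}_{n},\{\Phi_n\}_{n})$ in $\mathcal{B}(\mathcal{X},\mathcal{Y})$, the following are equivalent. (i) $B_n=A_nR_{A,B}$, $\Phi_n=L_{\Psi,\Phi}\Psi_n$, $\forall n\in\mathbb{N}$, for some invertible $R_{A,B},L_{\Psi,\Phi}\in\mathcal{B}(\mathcal{X})$. (ii) $\theta_B=\theta_AR_{A,B}$, $\theta_\Phi=L_{\Psi,\Phi}\theta_\Psi$ for some invertible $R_{A,B},L_{\Psi,\Phi}\in\mathcal{B}(\mathcal{X})$. (iii) $P_{B,\Phi}=P_{A,\Psi}$. If one of the conditions (i), (ii), (iii) is satisfied, then the invertible operators in (i) and (ii) are unique and are given by $R_{A,B}=S_{A,\Psi}^{-1}\theta_\Psi\theta_B$, $L_{\Psi,\Phi}=\theta_\Phi\theta_AS_{A,\Psi}^{-1}$. In this case, if $(\{A_n\}_{n},\{\Psi_n\}_{n})$ is Parseval, then $(\{B_n\}_{n},\{\Phi_n\}_{n})$ is Parseval if and only if $L_{\Psi,\Phi}R_{A,B}=I_{\mathcal{X}}$ if and only if $R_{A,B}L_{\Psi,\Phi}=I_{\mathcal{X}}$.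
   Context: Banach spaces are over $\mathbb{K}=\mathbb{R}$ or $\mathbb{C}$; $\mathcal{X},\mathcal{Y}$ are Banach spaces, $p\in[1,\infty)$, $\mathcal{B}(\mathcal{X},\mathcal{Y})$ is the space of bounded linear operators and $\mathcal{B}(\mathcal{X})=\mathcal{B}(\mathcal{X},\mathcal{X})$. $\ell^p(\mathbb{N})\otimes\mathcal{Y}$ is the completion of the algebraic tensor product in a fixed cross norm ($\|a\otimes y\|=\|a\|\|y\|$) for which, for all $T\in\mathcal{B}(\ell^p(\mathbb{N}))$ and $R\in\mathcal{B}(\mathcal{Y})$, $T\otimes R$ extends to a bounded operator with $\|T\otimes R\|\le\|T\|\|R\|$. With $\{e_n\}_n$ the standard Schauder basis of $\ell^p(\mathbb{N})$, $L_n:\mathcal{Y}\to\ell^p(\mathbb{N})\otimes\mathcal{Y}$ is $L_ny=e_n\otimes y$, and $\Gamma_n:\ell^p(\mathbb{N})\otimes\mathcal{Y}\to\mathcal{Y}$ is the bounded linear operator with $\Gamma_n(\{a_m\}_m\otimes y)=a_ny$. Thus $\Gamma_nL_n=I_{\mathcal{Y}}$, $\Gamma_nL_m=0$ for $n\ne m$, and $\sum_{n=1}^\infty L_n\Gamma_nz=z$ for all $z$. For collections $\{A_n\}_{n}$ in $\mathcal{B}(\mathcal{X},\mathcal{Y})$ and $\{\Psi_n\}_{n}$ in $\mathcal{B}(\mathcal{Y},\mathcal{X})$, the pair is an operator-valued p-approximate Schauder frame (operator-valued p-ASF) in $\mathcal{B}(\mathcal{X},\mathcal{Y})$ if: (i)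 the frame operator $S_{A,\Psi}x=\sum_{n=1}^\infty\Psi_nA_nx$ is a well-defined bounded linear invertible operator on $\mathcal{X}$; (ii) the analysis operator $\theta_A:\mathcal{X}\to\ell^p(\mathbb{N})\otimes\mathcal{Y}$, $\theta_Ax=\sum_{n=1}^\infty L_nA_nx$, is a well-defined bounded linear operator; (iii) the synthesis operator $\theta_\Psi:\ell^p(\mathbb{N})\otimes\mathcal{Y}\to\mathcal{X}$, $\theta_\Psi z=\sum_{n=1}^\infty\Psi_n\Gamma_nz$, is a well-defined bounded linear operator. It is Parseval if $S_{A,\Psi}=I_{\mathcal{X}}$. Put $P_{A,\Psi}=\theta_AS_{A,\Psi}^{-1}\theta_\Psi$. *)

theory Defs
  imports "HOL-Analysis.Analysis" "HOL-Library.Poly_Mapping"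
begin

section \<open>Banach spaces over the reals or the complex numbers\<close>

text \<open>The scalar field is a type that is isometrically isomorphic, as a field, to the reals or to
  the complex numbers.\<close>

class real_or_complex = real_normed_field +
  assumes real_or_complex:
    "(\<exists>f :: 'a \<Rightarrow> real. bij f \<and> (\<forall>x y. f (x + y) = f x + f y) \<and> (\<forall>x y. f (x * y) = f x * f y) \<and>
        (\<forall>x. norm (f x) = norm x)) \<or>
     (\<exists>f :: 'a \<Rightarrow> complex. bij f \<and> (\<forall>x y. f (x + y) = f x + f y) \<and> (\<forall>x y. f (x * y) = f x * f y) \<and>
        (\<forall>x. norm (f x) = norm x))"

instance real :: real_or_complex
  by standard (rule disjI1, rule exI[of _ "\<lambda>x. x"], simp add: bij_id[unfolded id_def])

instance complex :: real_or_complex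
  by standard (rule disjI2, rule exI[of _ "\<lambda>x. x"], simp add: bij_id[unfolded id_def])

text \<open>The class \<open>banach\<close> only provides real scalars; multiplication by the scalars of the field
  \<open>'k\<close> is a parameter, which extends the real multiplication of the class.\<close>

locale banach_space_over = vector_space scale
  for scale :: "'k::real_or_complex \<Rightarrow> 'x::banach \<Rightarrow> 'x" +
  assumes norm_scale: "norm (scale c x) = norm c * norm x"
    and scale_of_real: "scale (of_real r) x = r *\<^sub>R x"

definition bounded_ops ::
  "('k::real_or_complex \<Rightarrow> 'x::banach \<Rightarrow> 'x) \<Rightarrow> ('k \<Rightarrow> 'y::banach \<Rightarrow> 'y) \<Rightarrow> ('x \<Rightarrow> 'y) set"
  where "bounded_ops sX sY = {T. Vector_Spaces.linear sX sY T \<and> bounded_linear T}"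

definition invertible_ops :: "('k::real_or_complex \<Rightarrow> 'x::banach \<Rightarrow> 'x) \<Rightarrow> ('x \<Rightarrow> 'x) set"
  where "invertible_ops sX =
    {T \<in> bounded_ops sX sX. \<exists>U \<in> bounded_ops sX sX. U \<circ> T = id \<and> T \<circ> U = id}"


section \<open>The sequence space and its bounded operators\<close>

text \<open>Sequences are indexed by \<open>0, 1, 2, \<dots>\<close> instead of \<open>1, 2, 3, \<dots>\<close>.\<close>

definition lp :: "real \<Rightarrow> (nat \<Rightarrow> 'k::real_or_complex) set"
  where "lp p = {a. summable (\<lambda>n. norm (a n) powr p)}"

definition lp_norm :: "real \<Rightarrow> (nat \<Rightarrow> 'k::real_or_complex) \<Rightarrow> real"
  where "lp_norm p a = suminf (\<lambda>n. norm (a n) powr p) powr (1 / p)"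

definition lp_basis :: "nat \<Rightarrow> nat \<Rightarrow> 'k::real_or_complex"
  where "lp_basis n = (\<lambda>m. if m = n then 1 else 0)"

definition lp_bounded_ops ::
  "real \<Rightarrow> ((nat \<Rightarrow> 'k::real_or_complex) \<Rightarrow> (nat \<Rightarrow> 'k)) set"
  where "lp_bounded_ops p = {T.
    (\<forall>a \<in> lp p. T a \<in> lp p) \<and>
    (\<forall>a \<in> lp p. \<forall>b \<in> lp p. T (\<lambda>n. a n + b n) = (\<lambda>n. T a n + T b n)) \<and>
    (\<forall>c. \<forall>a \<in> lp p. T (\<lambda>n. c * a n) = (\<lambda>n. c * T a n)) \<and>
    (\<exists>C. \<forall>a \<in> lp p. lp_norm p (T a) \<le> C * lp_norm p a)}"

text \<open>The operator norm; as in \<open>onorm\<close>, the quotient is \<open>0\<close> at \<open>a = 0\<close>.\<close>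

definition lp_onorm :: "real \<Rightarrow> ((nat \<Rightarrow> 'k::real_or_complex) \<Rightarrow> (nat \<Rightarrow> 'k)) \<Rightarrow> real"
  where "lp_onorm p T = (SUP a \<in> lp p. lp_norm p (T a) / lp_norm p a)"


section \<open>The completed tensor product\<close>

text \<open>The algebraic tensor product is the free vector space on pairs \<open>(a, y)\<close>, i.e. the finitely
  supported functions, modulo the span of the bilinearity relations.\<close>

definition free_scale :: "'k::real_or_complex \<Rightarrow> ('v \<Rightarrow>\<^sub>0 'k) \<Rightarrow> ('v \<Rightarrow>\<^sub>0 'k)"
  where "free_scale c = Poly_Mapping.map ((*) c)"

lemma lookup_free_scale: "Poly_Mapping.lookup (free_scale c f) v = c * Poly_Mapping.lookup f v"
  by (simp add: free_scale_def Poly_Mapping.map.rep_eq when_def)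

lemma vector_space_free_scale: "vector_space free_scale"
  by standard (auto intro!: poly_mapping_eqI simp: lookup_free_scale lookup_add algebra_simps)

definition tensor_relations ::
  "real \<Rightarrow> ('k::real_or_complex \<Rightarrow> 'y::banach \<Rightarrow> 'y) \<Rightarrow> ((nat \<Rightarrow> 'k) \<times> 'y \<Rightarrow>\<^sub>0 'k) set"
  where "tensor_relations p sY =
    (let g = (\<lambda>a y. Poly_Mapping.single (a, y) 1) in
      {g (\<lambda>n. a n + b n) y - g a y - g b y | a b y. a \<in> lp p \<and> b \<in> lp p} \<union>
      {g a (y + z) - g a y - g a z | a y z. a \<in> lp p} \<union>
      {g (\<lambda>n. c * a n) y - free_scale c (g a y) | c a y. a \<in> lp p} \<union>
      {g a (sY c y) - free_scale c (g a y) | c a y. a \<in> lp p})"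

text \<open>The Banach space \<open>'z\<close>, with elementary tensors \<open>tens a y\<close>, is a completion of the algebraic
  tensor product for a norm of the required kind: the linear map induced by \<open>tens\<close> on the
  algebraic tensor product is well defined by bilinearity, injective by \<open>tens_inj\<close>, and has dense
  range by \<open>tens_dense\<close>; the norm of \<open>'z\<close> restricted to its range is the chosen cross norm.
  Values of \<open>tens a y\<close> with \<open>a\<close> outside \<open>lp p\<close> are irrelevant.\<close>

locale lp_tensor_product = Y: banach_space_over sY + Z: banach_space_over sZ
  for sY :: "'k::real_or_complex \<Rightarrow> 'y::banach \<Rightarrow> 'y"
    and sZ :: "'k \<Rightarrow> 'z::banach \<Rightarrow> 'z" +
  fixes p :: real and tens :: "(nat \<Rightarrow> 'k) \<Rightarrow> 'y \<Rightarrow> 'z"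
  assumes p_ge_1: "1 \<le> p"
    and tens_add_left: "\<lbrakk>a \<in> lp p; b \<in> lp p\<rbrakk> \<Longrightarrow> tens (\<lambda>n. a n + b n) y = tens a y + tens b y"
    and tens_add_right: "a \<in> lp p \<Longrightarrow> tens a (y + z) = tens a y + tens a z"
    and tens_scale_left: "a \<in> lp p \<Longrightarrow> tens (\<lambda>n. c * a n) y = sZ c (tens a y)"
    and tens_scale_right: "a \<in> lp p \<Longrightarrow> tens a (sY c y) = sZ c (tens a y)"
    and tens_inj: "\<lbrakk>Poly_Mapping.keys f \<subseteq> lp p \<times> UNIV;
        (\<Sum>v \<in> Poly_Mapping.keys f. sZ (Poly_Mapping.lookup f v) (tens (fst v) (snd v))) = 0\<rbrakk>
        \<Longrightarrow> f \<in> module.span free_scale (tensor_relations p sY)"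
    and tens_dense: "closure (Z.span {tens a y | a y. a \<in> lp p}) = UNIV"
    and tens_cross_norm: "a \<in> lp p \<Longrightarrow> norm (tens a y) = lp_norm p a * norm y"
    and tens_operators: "\<lbrakk>T \<in> lp_bounded_ops p; R \<in> bounded_ops sY sY\<rbrakk> \<Longrightarrow>
        \<exists>U \<in> bounded_ops sZ sZ. (\<forall>a \<in> lp p. \<forall>y. U (tens a y) = tens (T a) (R y)) \<and>
          onorm U \<le> lp_onorm p T * onorm R"

definition L_op :: "((nat \<Rightarrow> 'k::real_or_complex) \<Rightarrow> 'y::banach \<Rightarrow> 'z::banach) \<Rightarrow> nat \<Rightarrow> 'y \<Rightarrow> 'z"
  where "L_op tens n y = tens (lp_basis n) y"

definition Gamma_op ::
  "('k::real_or_complex \<Rightarrow> 'y::banach \<Rightarrow> 'y) \<Rightarrow> ('k \<Rightarrow> 'z::banach \<Rightarrow> 'z) \<Rightarrow> real \<Rightarrow>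
    ((nat \<Rightarrow> 'k) \<Rightarrow> 'y \<Rightarrow> 'z) \<Rightarrow> nat \<Rightarrow> 'z \<Rightarrow> 'y"
  where "Gamma_op sY sZ p tens n =
    (THE G. G \<in> bounded_ops sZ sY \<and> (\<forall>a \<in> lp p. \<forall>y. G (tens a y) = sY (a n) y))"


section \<open>Operator-valued p-approximate Schauder frames\<close>

definition frame_op :: "(nat \<Rightarrow> 'x::banach \<Rightarrow> 'y::banach) \<Rightarrow> (nat \<Rightarrow> 'y \<Rightarrow> 'x) \<Rightarrow> 'x \<Rightarrow> 'x"
  where "frame_op A \<Psi> x = suminf (\<lambda>n. \<Psi> n (A n x))"

definition analysis_op ::
  "((nat \<Rightarrow> 'k::real_or_complex) \<Rightarrow> 'y::banach \<Rightarrow> 'z::banach) \<Rightarrow> (nat \<Rightarrow> 'x::banach \<Rightarrow> 'y) \<Rightarrow> 'x \<Rightarrow> 'z"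
  where "analysis_op tens A x = suminf (\<lambda>n. L_op tens n (A n x))"

definition synthesis_op ::
  "('k::real_or_complex \<Rightarrow> 'y::banach \<Rightarrow> 'y) \<Rightarrow> ('k \<Rightarrow> 'z::banach \<Rightarrow> 'z) \<Rightarrow> real \<Rightarrow>
    ((nat \<Rightarrow> 'k) \<Rightarrow> 'y \<Rightarrow> 'z) \<Rightarrow> (nat \<Rightarrow> 'y \<Rightarrow> 'x::banach) \<Rightarrow> 'z \<Rightarrow> 'x"
  where "synthesis_op sY sZ p tens \<Psi> z = suminf (\<lambda>n. \<Psi> n (Gamma_op sY sZ p tens n z))"

definition p_ASF ::
  "('k::real_or_complex \<Rightarrow> 'x::banach \<Rightarrow> 'x) \<Rightarrow> ('k \<Rightarrow> 'y::banach \<Rightarrow> 'y) \<Rightarrow> ('k \<Rightarrow> 'z::banach \<Rightarrow> 'z) \<Rightarrow>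
    real \<Rightarrow> ((nat \<Rightarrow> 'k) \<Rightarrow> 'y \<Rightarrow> 'z) \<Rightarrow> (nat \<Rightarrow> 'x \<Rightarrow> 'y) \<Rightarrow> (nat \<Rightarrow> 'y \<Rightarrow> 'x) \<Rightarrow> bool"
  where "p_ASF sX sY sZ p tens A \<Psi> \<longleftrightarrow>
    (\<forall>n. A n \<in> bounded_ops sX sY) \<and> (\<forall>n. \<Psi> n \<in> bounded_ops sY sX) \<and>
    (\<forall>x. summable (\<lambda>n. \<Psi> n (A n x))) \<and> frame_op A \<Psi> \<in> invertible_ops sX \<and>
    (\<forall>x. summable (\<lambda>n. L_op tens n (A n x))) \<and> analysis_op tens A \<in> bounded_ops sX sZ \<and>
    (\<forall>z. summable (\<lambda>n. \<Psi> n (Gamma_op sY sZ p tens n z))) \<and>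
      synthesis_op sY sZ p tens \<Psi> \<in> bounded_ops sZ sX"

definition parseval :: "(nat \<Rightarrow> 'x::banach \<Rightarrow> 'y::banach) \<Rightarrow> (nat \<Rightarrow> 'y \<Rightarrow> 'x) \<Rightarrow> bool"
  where "parseval A \<Psi> \<longleftrightarrow> frame_op A \<Psi> = id"

definition frame_projection ::
  "('k::real_or_complex \<Rightarrow> 'y::banach \<Rightarrow> 'y) \<Rightarrow> ('k \<Rightarrow> 'z::banach \<Rightarrow> 'z) \<Rightarrow> real \<Rightarrow>
    ((nat \<Rightarrow> 'k) \<Rightarrow> 'y \<Rightarrow> 'z) \<Rightarrow> (nat \<Rightarrow> 'x::banach \<Rightarrow> 'y) \<Rightarrow> (nat \<Rightarrow> 'y \<Rightarrow> 'x) \<Rightarrow> 'z \<Rightarrow> 'z"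
  where "frame_projection sY sZ p tens A \<Psi> =
    analysis_op tens A \<circ> inv (frame_op A \<Psi>) \<circ> synthesis_op sY sZ p tens \<Psi>"

end

theory Submission
  imports Defs
begin

text \<open>
  The coordinate operators satisfy \<open>\<Gamma>\<^sub>n \<circ> L\<^sub>m = \<delta>\<^sub>n\<^sub>m I\<close>, so a frame pair is recovered from its analysis
  and synthesis operators by \<open>A\<^sub>n = \<Gamma>\<^sub>n \<circ> \<theta>\<^sub>A\<close> and \<open>\<Psi>\<^sub>n = \<theta>\<^sub>\<Psi> \<circ> L\<^sub>n\<close>
  (\<open>Gamma_analysis\<close>, \<open>synthesis_L\<close>). A coordinatewise relation between two frames is therefore the
  same as a relation between their analysis and synthesis operators
  (\<open>coordinatewise_iff_operator_relation\<close>), and the frame operator factors as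
  \<open>S\<^sub>A\<^sub>,\<^sub>\<Psi> = \<theta>\<^sub>\<Psi> \<circ> \<theta>\<^sub>A\<close> (\<open>synthesis_analysis\<close>).

  From this factorization on, only composition of maps matters. Cancelling \<open>S\<^sub>A\<^sub>,\<^sub>\<Psi>\<close> in
  \<open>\<theta>\<^sub>\<Psi> \<circ> \<theta>\<^sub>B = S\<^sub>A\<^sub>,\<^sub>\<Psi> \<circ> R\<close> and \<open>\<theta>\<^sub>\<Phi> \<circ> \<theta>\<^sub>A = L \<circ> S\<^sub>A\<^sub>,\<^sub>\<Psi>\<close> determines \<open>R\<close> and \<open>L\<close>
  (\<open>transition_operators_unique\<close>). The map \<open>P\<^sub>A\<^sub>,\<^sub>\<Psi>\<close> fixes \<open>\<theta>\<^sub>A\<close> on its left and \<open>\<theta>\<^sub>\<Psi>\<close> on its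
  right; if \<open>P\<^sub>B\<^sub>,\<^sub>\<Phi> = P\<^sub>A\<^sub>,\<^sub>\<Psi>\<close>, then \<open>\<theta>\<^sub>B = P\<^sub>A\<^sub>,\<^sub>\<Psi> \<circ> \<theta>\<^sub>B\<close> and \<open>\<theta>\<^sub>\<Phi> = \<theta>\<^sub>\<Phi> \<circ> P\<^sub>A\<^sub>,\<^sub>\<Psi>\<close> display the
  two transition operators (\<open>same_projection_imp_related\<close>). Conversely, the transition operators
  cancel in \<open>P\<^sub>B\<^sub>,\<^sub>\<Phi>\<close> because \<open>S\<^sub>B\<^sub>,\<^sub>\<Phi> = L \<circ> S\<^sub>A\<^sub>,\<^sub>\<Psi> \<circ> R\<close> (\<open>related_imp_same_projection\<close>); this
  formula also settles the Parseval case.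

  The analytic work is the existence of \<open>\<Gamma>\<^sub>n\<close> (\<open>Gamma_op_exists\<close>). The assumption on tensor products of
  operators provides the operator \<open>a \<otimes> y \<mapsto> a\<^sub>n e\<^sub>n \<otimes> y\<close>, and \<open>\<Gamma>\<^sub>n\<close> is obtained from it by
  inverting the isometry \<open>L\<^sub>n\<close>.
\<close>

section \<open>Bounded and invertible operators\<close>

lemma bounded_ops_bounded_linear: "T \<in> bounded_ops sX sY \<Longrightarrow> bounded_linear T"
  by (simp add: bounded_ops_def)

lemma bounded_ops_compose:
  "\<lbrakk>T \<in> bounded_ops sX sY; U \<in> bounded_ops sY sZ\<rbrakk> \<Longrightarrow> U \<circ> T \<in> bounded_ops sX sZ"
  using bounded_linear_compose[of U T]
  by (auto simp: bounded_ops_def Vector_Spaces.linear_iff o_def)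

lemma invertible_ops_inv:
  assumes "S \<in> invertible_ops sX"
  shows "inv S \<in> bounded_ops sX sX" "inv S \<circ> S = id" "S \<circ> inv S = id"
proof -
  obtain U where U: "U \<in> bounded_ops sX sX" "U \<circ> S = id" "S \<circ> U = id"
    using assms by (auto simp: invertible_ops_def)
  then have "inv S = U"
    by (metis inv_unique_comp)
  then show "inv S \<in> bounded_ops sX sX" "inv S \<circ> S = id" "S \<circ> inv S = id"
    using U by auto
qed

lemma invertible_ops_bounded: "S \<in> invertible_ops sX \<Longrightarrow> S \<in> bounded_ops sX sX"
  by (simp add: invertible_ops_def)

lemma invertible_ops_left_right_inverse:
  assumes "R \<in> invertible_ops sX"
  shows "L \<circ> R = id \<longleftrightarrow> R \<circ> L = id"
  using invertible_ops_inv(2,3)[OF assms] left_right_inverse_eq by metis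

section \<open>Factorizations of invertible maps\<close>

text \<open>The maps \<open>\<theta>\<close>, \<open>\<theta>'\<close> and \<open>\<eta>\<close>, \<open>\<eta>'\<close> below stand for the analysis and synthesis operators of
  two frames; \<open>S'\<close> and \<open>T'\<close> invert the two frame operators \<open>\<theta>' \<circ> \<theta>\<close> and \<open>\<eta>' \<circ> \<eta>\<close>.\<close>

lemma transition_operators_unique:
  assumes "S' \<circ> (\<theta>' \<circ> \<theta>) = id" "(\<theta>' \<circ> \<theta>) \<circ> S' = id"
    and "\<eta> = \<theta> \<circ> R" "\<eta>' = L \<circ> \<theta>'"
  shows "R = S' \<circ> \<theta>' \<circ> \<eta>" "L = \<eta>' \<circ> \<theta> \<circ> S'"
  using assms by (auto simp: fun_eq_iff)

lemma related_imp_same_projection: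
  assumes S: "(\<theta>' \<circ> \<theta>) \<circ> S' = id"
    and T: "T' \<circ> (\<eta>' \<circ> \<eta>) = id"
    and R: "R \<circ> R' = id" and rel: "\<eta> = \<theta> \<circ> R" "\<eta>' = L \<circ> \<theta>'"
  shows "\<eta> \<circ> T' \<circ> \<eta>' = \<theta> \<circ> S' \<circ> \<theta>'"
proof
  fix z
  \<comment> \<open>The value of \<open>T' (\<eta>' z)\<close> that \<open>\<eta>' \<circ> \<eta> = L \<circ> (\<theta>' \<circ> \<theta>) \<circ> R\<close> suggests.\<close>
  define x where "x = R' (S' (\<theta>' z))"
  have Rx: "R x = S' (\<theta>' z)"
    using R by (simp add: x_def fun_eq_iff)
  then have "\<eta>' z = \<eta>' (\<eta> x)"
    using rel S by (simp add: fun_eq_iff)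
  then have "T' (\<eta>' z) = x"
    using T by (simp add: fun_eq_iff)
  then show "(\<eta> \<circ> T' \<circ> \<eta>') z = (\<theta> \<circ> S' \<circ> \<theta>') z"
    using Rx rel by simp
qed

lemma same_projection_imp_related:
  assumes T: "T' \<circ> (\<eta>' \<circ> \<eta>) = id" "(\<eta>' \<circ> \<eta>) \<circ> T' = id"
    and P: "\<eta> \<circ> T' \<circ> \<eta>' = \<theta> \<circ> S' \<circ> \<theta>'"
  shows "\<eta> = \<theta> \<circ> (S' \<circ> \<theta>' \<circ> \<eta>)" "\<eta>' = (\<eta>' \<circ> \<theta> \<circ> S') \<circ> \<theta>'"
proof -
  have "\<eta> = (\<eta> \<circ> T' \<circ> \<eta>') \<circ> \<eta>"
    using T(1) by (auto simp: fun_eq_iff)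
  then show "\<eta> = \<theta> \<circ> (S' \<circ> \<theta>' \<circ> \<eta>)"
    unfolding P by (simp add: comp_assoc)
  have "\<eta>' = \<eta>' \<circ> (\<eta> \<circ> T' \<circ> \<eta>')"
    using T(2) by (auto simp: fun_eq_iff)
  then show "\<eta>' = (\<eta>' \<circ> \<theta> \<circ> S') \<circ> \<theta>'"
    unfolding P by (simp add: comp_assoc)
qed

text \<open>The inverses of the transition operators are the transition operators in the opposite
  direction, since each pair factors through the other by the preceding lemma.\<close>

lemma same_projection_transition_inverse:
  assumes S: "S' \<circ> (\<theta>' \<circ> \<theta>) = id" "(\<theta>' \<circ> \<theta>) \<circ> S' = id"
    and T: "T' \<circ> (\<eta>' \<circ> \<eta>) = id" "(\<eta>' \<circ> \<eta>) \<circ> T' = id"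
    and P: "\<eta> \<circ> T' \<circ> \<eta>' = \<theta> \<circ> S' \<circ> \<theta>'"
  shows "(T' \<circ> \<eta>' \<circ> \<theta>) \<circ> (S' \<circ> \<theta>' \<circ> \<eta>) = id"
    and "(\<eta>' \<circ> \<theta> \<circ> S') \<circ> (\<theta>' \<circ> \<eta> \<circ> T') = id"
proof -
  note rel = same_projection_imp_related[OF T P]
  have "(T' \<circ> \<eta>' \<circ> \<theta>) \<circ> (S' \<circ> \<theta>' \<circ> \<eta>) = T' \<circ> \<eta>' \<circ> (\<theta> \<circ> (S' \<circ> \<theta>' \<circ> \<eta>))"
    by (simp add: comp_assoc)
  then show "(T' \<circ> \<eta>' \<circ> \<theta>) \<circ> (S' \<circ> \<theta>' \<circ> \<eta>) = id"
    unfolding rel(1)[symmetric] using T(1) by (simp add: comp_assoc)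
  have "(\<eta>' \<circ> \<theta> \<circ> S') \<circ> (\<theta>' \<circ> \<eta> \<circ> T') = ((\<eta>' \<circ> \<theta> \<circ> S') \<circ> \<theta>') \<circ> \<eta> \<circ> T'"
    by (simp add: comp_assoc)
  then show "(\<eta>' \<circ> \<theta> \<circ> S') \<circ> (\<theta>' \<circ> \<eta> \<circ> T') = id"
    unfolding rel(2)[symmetric] using T(2) by (simp add: comp_assoc)
qed

section \<open>Coordinate projections of the sequence space\<close>

lemma sums_single_coordinate: "(\<lambda>m. norm (if m = n then c else 0) powr p) sums (norm c powr p)"
proof -
  have "(\<lambda>m. norm (if m = n then c else 0) powr p) = (\<lambda>m. if m = n then norm c powr p else 0)"
    by auto
  then show ?thesis
    using sums_single[of n "\<lambda>_. norm c powr p"] by simp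
qed

lemma single_coordinate_in_lp: "(\<lambda>m. if m = n then c else 0) \<in> lp p"
  using sums_single_coordinate[of n c p] by (simp add: lp_def sums_iff)

lemma lp_norm_single_coordinate:
  "1 \<le> p \<Longrightarrow> lp_norm p (\<lambda>m. if m = n then c else 0) = norm c"
  using sums_single_coordinate[of n c p] by (simp add: lp_norm_def sums_iff powr_powr)

lemma lp_basis_in_lp: "lp_basis n \<in> lp p"
  unfolding lp_basis_def by (rule single_coordinate_in_lp)

lemma lp_coordinate_le_norm:
  assumes p: "1 \<le> p" and a: "a \<in> lp p"
  shows "norm (a n) \<le> lp_norm p a"
proof -
  have "norm (a n) powr p \<le> suminf (\<lambda>n. norm (a n) powr p)"
    using a sum_le_suminf[of "\<lambda>n. norm (a n) powr p" "{n}"] by (simp add: lp_def)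
  then have "(norm (a n) powr p) powr (1 / p) \<le> lp_norm p a"
    unfolding lp_norm_def using p by (intro powr_mono2) auto
  then show ?thesis
    using p by (simp add: powr_powr)
qed

lemma coordinate_projection_bounded:
  assumes "1 \<le> p"
  shows "(\<lambda>a m. if m = n then a n else 0) \<in> lp_bounded_ops p"
proof -
  have "\<forall>a \<in> lp p. lp_norm p (\<lambda>m. if m = n then a n else 0) \<le> 1 * lp_norm p a"
    using assms by (simp add: lp_norm_single_coordinate lp_coordinate_le_norm)
  then show ?thesis
    unfolding lp_bounded_ops_def
    by (auto simp: single_coordinate_in_lp fun_eq_iff simp del: mult_1 intro!: exI[of _ 1])
qed

section \<open>Coordinate operators on the tensor product\<close>

context lp_tensor_product
begin

lemma L_op_bounded: "L_op tens n \<in> bounded_ops sY sZ"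
proof -
  have add: "L_op tens n (x + y) = L_op tens n x + L_op tens n y" for x y
    by (simp add: L_op_def tens_add_right lp_basis_in_lp)
  have scale: "L_op tens n (sY c y) = sZ c (L_op tens n y)" for c y
    by (simp add: L_op_def tens_scale_right lp_basis_in_lp)
  have "bounded_linear (L_op tens n)"
  proof (rule bounded_linear_intro[where K = "lp_norm p (lp_basis n :: nat \<Rightarrow> 'k)"])
    show "L_op tens n (r *\<^sub>R y) = r *\<^sub>R L_op tens n y" for r y
      using scale[of "of_real r" y] by (simp add: Y.scale_of_real Z.scale_of_real)
    show "norm (L_op tens n y) \<le> norm y * lp_norm p (lp_basis n :: nat \<Rightarrow> 'k)" for y
      by (simp add: L_op_def tens_cross_norm lp_basis_in_lp)
  qed (rule add)
  then show ?thesis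
    by (simp add: bounded_ops_def Vector_Spaces.linear_iff add scale
        Y.vector_space_axioms Z.vector_space_axioms)
qed

lemma norm_L_op: "norm (L_op tens n y) = norm y"
proof -
  have "lp_norm p (lp_basis n :: nat \<Rightarrow> 'k) = 1"
    unfolding lp_basis_def using p_ge_1 by (simp add: lp_norm_single_coordinate)
  then show ?thesis
    by (simp add: L_op_def tens_cross_norm lp_basis_in_lp)
qed

lemma closed_range_L_op: "closed (range (L_op tens n))"
proof -
  have "complete (range (L_op tens n))"
    by (rule complete_isometric_image[of 1])
      (auto simp: norm_L_op bounded_ops_bounded_linear[OF L_op_bounded] complete_UNIV)
  then show ?thesis
    by (rule complete_imp_closed)
qed

text \<open>Both the existence and the uniqueness of \<open>\<Gamma>\<^sub>n\<close> are extended from elementary tensors to the whole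
  space by this density principle.\<close>

lemma closed_subspace_of_tensors_eq_UNIV:
  assumes "Z.subspace W" "closed W" "\<And>a y. a \<in> lp p \<Longrightarrow> tens a y \<in> W"
  shows "W = UNIV"
proof -
  have "Z.span {tens a y | a y. a \<in> lp p} \<subseteq> W"
    using assms by (intro Z.span_minimal) auto
  then have "closure (Z.span {tens a y | a y. a \<in> lp p}) \<subseteq> W"
    using assms(2) by (rule closure_minimal)
  then show ?thesis
    using tens_dense by auto
qed

text \<open>The operator \<open>U\<close> induced by the coordinate projection sends \<open>a \<otimes> y\<close> to \<open>L\<^sub>n (a\<^sub>n y)\<close>. The range
  of \<open>L\<^sub>n\<close> is closed because \<open>L\<^sub>n\<close> is isometric and \<open>'y\<close> is complete, so by density \<open>U\<close> maps
  everything into it, and \<open>\<Gamma>\<^sub>n = L\<^sub>n\<inverse> \<circ> U\<close> makes sense.\<close>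

lemma Gamma_op_exists:
  "\<exists>G \<in> bounded_ops sZ sY. \<forall>a \<in> lp p. \<forall>y. G (tens a y) = sY (a n) y"
proof -
  let ?L = "L_op tens n"
  let ?T = "\<lambda>a m. if m = n then a n else (0 :: 'k)"
  have id: "id \<in> bounded_ops sY sY"
    by (simp add: bounded_ops_def Vector_Spaces.linear_iff Y.vector_space_axioms
        bounded_linear_ident[folded id_def])
  from tens_operators[OF coordinate_projection_bounded[OF p_ge_1] id]
  obtain U where U: "U \<in> bounded_ops sZ sZ"
    and U_tens: "\<And>a y. a \<in> lp p \<Longrightarrow> U (tens a y) = tens (?T a) y"
    by (metis id_apply)
  have U_lin: "U (w + z) = U w + U z" "U (sZ c z) = sZ c (U z)" for w z c
    using U by (auto simp: bounded_ops_def Vector_Spaces.linear_iff)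
  have L_lin: "?L (x + y) = ?L x + ?L y" "?L (sY c y) = sZ c (?L y)" for x y c
    using L_op_bounded[of n] by (auto simp: bounded_ops_def Vector_Spaces.linear_iff)
  have L_diff: "?L (x - y) = ?L x - ?L y" for x y
    by (rule linear_diff)
      (rule bounded_linear.linear[OF bounded_ops_bounded_linear[OF L_op_bounded]])
  have L_eq: "?L x = ?L y \<longleftrightarrow> x = y" for x y
    using norm_L_op[of n "x - y"] by (auto simp: L_diff)
  have U_tens_L: "U (tens a y) = ?L (sY (a n) y)" if a: "a \<in> lp p" for a y
  proof -
    have "?T a = (\<lambda>m. a n * lp_basis n m)"
      by (auto simp: lp_basis_def)
    then show ?thesis
      using tens_scale_left[OF lp_basis_in_lp, of "a n" n y]
      by (simp add: U_tens[OF a] L_lin(2)) (simp add: L_op_def)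
  qed
  have "U -` range ?L = UNIV"
  proof (rule closed_subspace_of_tensors_eq_UNIV)
    have "0 = ?L 0" "U 0 = 0"
      using L_diff[of 0 0] U_lin(1)[of 0 0] by auto
    then show "Z.subspace (U -` range ?L)"
      unfolding Z.subspace_def
      by (auto simp: U_lin simp flip: L_lin)
    show "closed (U -` range ?L)"
      using U closed_range_L_op
      by (intro closed_vimage linear_continuous_on bounded_ops_bounded_linear[of U])
  qed (simp add: U_tens_L)
  then have "\<forall>z. \<exists>y. U z = ?L y"
    by auto
  then obtain G where G: "\<And>z. U z = ?L (G z)"
    by metis
  have "G (w + z) = G w + G z" "G (sZ c z) = sY c (G z)" for w z c
    by (simp_all add: G L_lin U_lin flip: L_eq)
       (simp_all add: U_lin flip: G)
  moreover from this have "G (r *\<^sub>R z) = r *\<^sub>R G z" for r z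
    by (metis Y.scale_of_real Z.scale_of_real)
  moreover obtain K where "\<And>z. norm (U z) \<le> norm z * K"
    using bounded_linear.bounded[OF bounded_ops_bounded_linear[OF U]] by blast
  then have "norm (G z) \<le> norm z * K" for z
    by (metis G norm_L_op)
  ultimately have "G \<in> bounded_ops sZ sY"
    by (auto simp: bounded_ops_def Vector_Spaces.linear_iff Y.vector_space_axioms
        Z.vector_space_axioms intro!: bounded_linear_intro)
  moreover have "G (tens a y) = sY (a n) y" if "a \<in> lp p" for a y
    using U_tens_L[OF that, of y] by (simp add: G L_eq)
  ultimately show ?thesis
    by auto
qed

lemma Gamma_op_unique:
  assumes G: "G \<in> bounded_ops sZ sY" "\<forall>a \<in> lp p. \<forall>y. G (tens a y) = sY (a n) y"
    and H: "H \<in> bounded_ops sZ sY" "\<forall>a \<in> lp p. \<forall>y. H (tens a y) = sY (a n) y"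
  shows "G = H"
proof -
  have lin: "G (w + z) = G w + G z" "G (sZ c z) = sY c (G z)"
      "H (w + z) = H w + H z" "H (sZ c z) = sY c (H z)" for w z c
    using G H by (auto simp: bounded_ops_def Vector_Spaces.linear_iff)
  have "{z. G z = H z} = UNIV"
  proof (rule closed_subspace_of_tensors_eq_UNIV)
    show "Z.subspace {z. G z = H z}"
      using lin(1)[of 0 0] lin(3)[of 0 0] by (simp add: Z.subspace_def lin)
    show "closed {z. G z = H z}"
      using G H by (intro closed_Collect_eq linear_continuous_on bounded_ops_bounded_linear)
  qed (use G H in simp)
  then show ?thesis
    by auto
qed

lemma Gamma_op:
  shows Gamma_op_bounded: "Gamma_op sY sZ p tens n \<in> bounded_ops sZ sY"
    and Gamma_op_tens: "a \<in> lp p \<Longrightarrow> Gamma_op sY sZ p tens n (tens a y) = sY (a n) y"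
proof -
  have "\<exists>!G. G \<in> bounded_ops sZ sY \<and> (\<forall>a \<in> lp p. \<forall>y. G (tens a y) = sY (a n) y)"
    using Gamma_op_exists Gamma_op_unique by blast
  from theI'[OF this, folded Gamma_op_def]
  show "Gamma_op sY sZ p tens n \<in> bounded_ops sZ sY"
    and "a \<in> lp p \<Longrightarrow> Gamma_op sY sZ p tens n (tens a y) = sY (a n) y"
    by auto
qed

lemma Gamma_L: "Gamma_op sY sZ p tens n (L_op tens m y) = (if n = m then y else 0)"
  unfolding L_op_def Gamma_op_tens[OF lp_basis_in_lp] by (simp add: lp_basis_def)

section \<open>Analysis and synthesis operators\<close>

lemma Gamma_analysis:
  assumes "summable (\<lambda>m. L_op tens m (A m x))"
  shows "Gamma_op sY sZ p tens n (analysis_op tens A x) = A n x"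
proof -
  have "Gamma_op sY sZ p tens n (analysis_op tens A x) =
      suminf (\<lambda>m. Gamma_op sY sZ p tens n (L_op tens m (A m x)))"
    unfolding analysis_op_def
    by (rule bounded_linear.suminf[OF bounded_ops_bounded_linear[OF Gamma_op_bounded] assms])
  also have "\<dots> = suminf (\<lambda>m. if m = n then A m x else 0)"
    by (simp add: Gamma_L eq_commute)
  also have "\<dots> = A n x"
    using sums_single[of n "\<lambda>m. A m x"] by (simp add: sums_iff)
  finally show ?thesis .
qed

lemma synthesis_L:
  assumes "\<And>m. \<Psi> m 0 = 0"
  shows "synthesis_op sY sZ p tens \<Psi> (L_op tens n y) = \<Psi> n y"
proof -
  have "(\<lambda>m. \<Psi> m (Gamma_op sY sZ p tens m (L_op tens n y))) = (\<lambda>m. if m = n then \<Psi> m y else 0)"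
    using assms by (auto simp: Gamma_L)
  then show ?thesis
    unfolding synthesis_op_def using sums_single[of n "\<lambda>m. \<Psi> m y"] by (simp add: sums_iff)
qed

lemma synthesis_analysis:
  assumes "\<And>x. summable (\<lambda>m. L_op tens m (A m x))"
  shows "synthesis_op sY sZ p tens \<Psi> \<circ> analysis_op tens A = frame_op A \<Psi>"
  by (simp add: fun_eq_iff synthesis_op_def frame_op_def Gamma_analysis[OF assms])

text \<open>One direction sums the coordinate relations, using continuity of \<open>L\<close>; the other applies
  \<open>\<Gamma>\<^sub>n\<close> on the left, respectively \<open>L\<^sub>n\<close> on the right.\<close>

lemma coordinatewise_iff_operator_relation:
  assumes A: "p_ASF sX sY sZ p tens A \<Psi>" and B: "p_ASF sX sY sZ p tens B \<Phi>"
    and L: "L \<in> bounded_ops sX sX"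
  shows "(\<forall>n. B n = A n \<circ> R \<and> \<Phi> n = L \<circ> \<Psi> n) \<longleftrightarrow>
    analysis_op tens B = analysis_op tens A \<circ> R \<and>
    synthesis_op sY sZ p tens \<Phi> = L \<circ> synthesis_op sY sZ p tens \<Psi>"
    (is "?coord \<longleftrightarrow> ?op")
proof
  assume ?coord
  then have rel: "B n x = A n (R x)" "\<Phi> n y = L (\<Psi> n y)" for n x y
    by auto
  have "synthesis_op sY sZ p tens \<Phi> z = L (synthesis_op sY sZ p tens \<Psi> z)" for z
    unfolding synthesis_op_def rel
    using A by (intro bounded_linear.suminf[symmetric] bounded_ops_bounded_linear[OF L])
      (simp add: p_ASF_def)
  then show ?op
    by (simp add: fun_eq_iff analysis_op_def rel)
next
  assume op: ?op
  have zero: "\<Psi> m 0 = 0" "\<Phi> m 0 = 0" for m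
    using A B linear_0[OF bounded_linear.linear[OF bounded_ops_bounded_linear]]
    unfolding p_ASF_def by blast+
  have "B n x = A n (R x)" for n x
    using Gamma_analysis[of B x n] Gamma_analysis[of A "R x" n] op A B by (simp add: p_ASF_def)
  moreover have "\<Phi> n y = L (\<Psi> n y)" for n y
    using synthesis_L[of \<Phi> n y] synthesis_L[of \<Psi> n y] op by (simp add: zero)
  ultimately show ?coord
    by auto
qed

end

section \<open>Equivalence of operator-valued frames\<close>

theorem theorem5p3:
  fixes sX :: "'k::real_or_complex \<Rightarrow> 'x::banach \<Rightarrow> 'x"
    and sY :: "'k \<Rightarrow> 'y::banach \<Rightarrow> 'y"
    and sZ :: "'k \<Rightarrow> 'z::banach \<Rightarrow> 'z"
    and p :: real
    and tens :: "(nat \<Rightarrow> 'k) \<Rightarrow> 'y \<Rightarrow> 'z"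
    and A B :: "nat \<Rightarrow> 'x \<Rightarrow> 'y"
    and \<Psi> \<Phi> :: "nat \<Rightarrow> 'y \<Rightarrow> 'x"
  assumes "banach_space_over sX"
    and "lp_tensor_product sY sZ p tens"
    and "p_ASF sX sY sZ p tens A \<Psi>"
    and "p_ASF sX sY sZ p tens B \<Phi>"
  shows
    "let \<theta> = analysis_op tens;
         \<theta>' = synthesis_op sY sZ p tens;
         P = frame_projection sY sZ p tens;
         rel_i = (\<lambda>R L. \<forall>n. B n = A n \<circ> R \<and> \<Phi> n = L \<circ> \<Psi> n);
         rel_ii = (\<lambda>R L. \<theta> B = \<theta> A \<circ> R \<and> \<theta>' \<Phi> = L \<circ> \<theta>' \<Psi>);
         cond_i = (\<exists>R \<in> invertible_ops sX. \<exists>L \<in> invertible_ops sX. rel_i R L);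
         cond_ii = (\<exists>R \<in> invertible_ops sX. \<exists>L \<in> invertible_ops sX. rel_ii R L);
         cond_iii = (P B \<Phi> = P A \<Psi>);
         R0 = inv (frame_op A \<Psi>) \<circ> \<theta>' \<Psi> \<circ> \<theta> B;
         L0 = \<theta>' \<Phi> \<circ> \<theta> A \<circ> inv (frame_op A \<Psi>)
     in (cond_i \<longleftrightarrow> cond_ii) \<and> (cond_ii \<longleftrightarrow> cond_iii) \<and>
        (cond_i \<or> cond_ii \<or> cond_iii \<longrightarrow>
           R0 \<in> invertible_ops sX \<and> L0 \<in> invertible_ops sX \<and>
           (\<forall>R \<in> invertible_ops sX. \<forall>L \<in> invertible_ops sX. rel_i R L \<longleftrightarrow> R = R0 \<and> L = L0) \<and>
           (\<forall>R \<in> invertible_ops sX. \<forall>L \<in> invertible_ops sX. rel_ii R L \<longleftrightarrow> R = R0 \<and> L = L0) \<and>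
           (parseval A \<Psi> \<longrightarrow>
              (parseval B \<Phi> \<longleftrightarrow> L0 \<circ> R0 = id) \<and> (L0 \<circ> R0 = id \<longleftrightarrow> R0 \<circ> L0 = id)))"
proof -
  interpret lp_tensor_product sY sZ p tens
    by (rule assms)
  define \<theta> \<theta>' \<eta> \<eta>' where "\<theta> = analysis_op tens A" and "\<theta>' = synthesis_op sY sZ p tens \<Psi>"
    and "\<eta> = analysis_op tens B" and "\<eta>' = synthesis_op sY sZ p tens \<Phi>"
  define S' T' where "S' = inv (frame_op A \<Psi>)" and "T' = inv (frame_op B \<Phi>)"
  define R0 L0 where "R0 = S' \<circ> \<theta>' \<circ> \<eta>" and "L0 = \<eta>' \<circ> \<theta> \<circ> S'"
  have SA: "frame_op A \<Psi> = \<theta>' \<circ> \<theta>" and SB: "frame_op B \<Phi> = \<eta>' \<circ> \<eta>"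
    unfolding \<theta>_def \<theta>'_def \<eta>_def \<eta>'_def using assms(3,4)
    by (simp_all add: p_ASF_def synthesis_analysis)
  have bounded: "\<theta> \<in> bounded_ops sX sZ" "\<eta> \<in> bounded_ops sX sZ"
      "\<theta>' \<in> bounded_ops sZ sX" "\<eta>' \<in> bounded_ops sZ sX"
    unfolding \<theta>_def \<theta>'_def \<eta>_def \<eta>'_def using assms(3,4) by (simp_all add: p_ASF_def)
  have "frame_op A \<Psi> \<in> invertible_ops sX" "frame_op B \<Phi> \<in> invertible_ops sX"
    using assms(3,4) by (simp_all add: p_ASF_def)
  note S = this(1)[THEN invertible_ops_inv(1), folded S'_def]
      this(1)[THEN invertible_ops_inv(2), folded S'_def, unfolded SA]
      this(1)[THEN invertible_ops_inv(3), folded S'_def, unfolded SA]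
    and T = this(2)[THEN invertible_ops_inv(1), folded T'_def]
      this(2)[THEN invertible_ops_inv(2), folded T'_def, unfolded SB]
      this(2)[THEN invertible_ops_inv(3), folded T'_def, unfolded SB]
  have unique: "R = R0 \<and> L = L0" if "\<eta> = \<theta> \<circ> R" "\<eta>' = L \<circ> \<theta>'" for R L
    using transition_operators_unique[OF S(2,3) that] by (simp add: R0_def L0_def)
  have ii_iii: "\<eta> \<circ> T' \<circ> \<eta>' = \<theta> \<circ> S' \<circ> \<theta>'"
    if "R \<in> invertible_ops sX" "\<eta> = \<theta> \<circ> R" "\<eta>' = L \<circ> \<theta>'" for R L
    by (rule related_imp_same_projection[OF S(3) T(2) invertible_ops_inv(3)[OF that(1)]
          that(2,3)])
  have iii_ii: "\<eta> = \<theta> \<circ> R0 \<and> \<eta>' = L0 \<circ> \<theta>' \<and> R0 \<in> invertible_ops sX \<and> L0 \<in> invertible_ops sX"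
    if P: "\<eta> \<circ> T' \<circ> \<eta>' = \<theta> \<circ> S' \<circ> \<theta>'"
  proof -
    \<comment> \<open>Exchanging the two frames in the second instance yields the inverses on the other side.\<close>
    note inverse = same_projection_transition_inverse[OF S(2,3) T(2,3) P]
      same_projection_transition_inverse[OF T(2,3) S(2,3) P[symmetric]]
    have "R0 \<in> bounded_ops sX sX" "L0 \<in> bounded_ops sX sX"
        "T' \<circ> \<eta>' \<circ> \<theta> \<in> bounded_ops sX sX" "\<theta>' \<circ> \<eta> \<circ> T' \<in> bounded_ops sX sX"
      unfolding R0_def L0_def using bounded S(1) T(1) by (blast intro: bounded_ops_compose)+
    with inverse have "R0 \<in> invertible_ops sX" "L0 \<in> invertible_ops sX"
      unfolding invertible_ops_def R0_def L0_def by blast+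
    with same_projection_imp_related[OF T(2,3) P] show ?thesis
      by (simp add: R0_def L0_def)
  qed
  have parseval: "parseval B \<Phi> \<longleftrightarrow> L0 \<circ> R0 = id"
    if "parseval A \<Psi>" "\<eta> = \<theta> \<circ> R0" "\<eta>' = L0 \<circ> \<theta>'"
  proof -
    have "frame_op B \<Phi> = L0 \<circ> (\<theta>' \<circ> \<theta>) \<circ> R0"
      unfolding SB by (subst that(2), subst that(3)) (simp add: comp_assoc)
    with that(1) show ?thesis
      by (simp add: parseval_def SA)
  qed
  have P: "frame_projection sY sZ p tens A \<Psi> = \<theta> \<circ> S' \<circ> \<theta>'"
    "frame_projection sY sZ p tens B \<Phi> = \<eta> \<circ> T' \<circ> \<eta>'"
    by (simp_all add: frame_projection_def \<theta>_def \<theta>'_def \<eta>_def \<eta>'_def S'_def T'_def)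
  define rel where "rel R L \<longleftrightarrow> \<eta> = \<theta> \<circ> R \<and> \<eta>' = L \<circ> \<theta>'" for R L
  define iii where "iii \<longleftrightarrow> \<eta> \<circ> T' \<circ> \<eta>' = \<theta> \<circ> S' \<circ> \<theta>'"
  let ?I = "invertible_ops sX"
  have coord_rel: "(\<forall>n. B n = A n \<circ> R \<and> \<Phi> n = L \<circ> \<Psi> n) \<longleftrightarrow> rel R L" if "L \<in> ?I" for R L
    unfolding rel_def \<theta>_def \<theta>'_def \<eta>_def \<eta>'_def
    by (rule coordinatewise_iff_operator_relation[OF assms(3,4) invertible_ops_bounded[OF that]])
  have i_ii: "(\<exists>R\<in>?I. \<exists>L\<in>?I. \<forall>n. B n = A n \<circ> R \<and> \<Phi> n = L \<circ> \<Psi> n) \<longleftrightarrow> (\<exists>R\<in>?I. \<exists>L\<in>?I. rel R L)"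
    by (simp add: coord_rel cong: bex_cong)
  have iff: "(\<exists>R\<in>?I. \<exists>L\<in>?I. rel R L) \<longleftrightarrow> iii"
    using ii_iii iii_ii unfolding rel_def iii_def by blast
  have rel_iff: "rel R L \<longleftrightarrow> R = R0 \<and> L = L0" if iii for R L
    using iii_ii unique that unfolding rel_def iii_def by blast
  have final: "R0 \<in> ?I \<and> L0 \<in> ?I \<and>
      (\<forall>R\<in>?I. \<forall>L\<in>?I. (\<forall>n. B n = A n \<circ> R \<and> \<Phi> n = L \<circ> \<Psi> n) \<longleftrightarrow> R = R0 \<and> L = L0) \<and>
      (\<forall>R\<in>?I. \<forall>L\<in>?I. rel R L \<longleftrightarrow> R = R0 \<and> L = L0) \<and>
      (parseval A \<Psi> \<longrightarrow> (parseval B \<Phi> \<longleftrightarrow> L0 \<circ> R0 = id) \<and> (L0 \<circ> R0 = id \<longleftrightarrow> R0 \<circ> L0 = id))"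
    if iii
  proof -
    from iii_ii that have facts: "\<eta> = \<theta> \<circ> R0" "\<eta>' = L0 \<circ> \<theta>'" "R0 \<in> ?I" "L0 \<in> ?I"
      unfolding iii_def by blast+
    with parseval invertible_ops_left_right_inverse[OF facts(3)] show ?thesis
      by (simp add: coord_rel rel_iff[OF that])
  qed
  show ?thesis
    unfolding Let_def P
    unfolding \<theta>_def[symmetric] \<theta>'_def[symmetric] \<eta>_def[symmetric] \<eta>'_def[symmetric]
      S'_def[symmetric]
    unfolding R0_def[symmetric] L0_def[symmetric] rel_def[symmetric] iii_def[symmetric]
    using i_ii iff final by blast
qed

end
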